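(* For arbitrarily large $m$, there are graphs with exactly $m$ edges which have a bisection of size at least $\frac34 m$, but for which $\max\{e(V_1), e(V_2)\} \ge \frac{m}{4}$ for every bisection $V_1 \cup V_2$ of the vertex set.
   Context: Graphs are finite and simple. A bisection of a graph is a bipartition $V = V_1 \cup V_2$ of its vertex set into disjoint parts with $\big||V_1|-|V_2|\big| \le 1$; its size is the number of edges with one endpoint in each part. For a vertex set $U$, $e(U)$ is the number of edges with both endpoints in $U$. *)

theory Defs
  imports Complex_Main
begin

text \<open>A finite simple graph is given by its vertex set and its edge set, an edge being
  the two-element set of its endpoints.\<close>

definition finite_simple_graph :: "'a set \<Rightarrow> 'a set set \<Rightarrow> bool" where
  "finite_simple_graph V E \<longleftrightarrow> finite V \<and> (\<forall>e\<in>E. e \<subseteq> V \<and> card e = 2)"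

definition bisection :: "'a set \<Rightarrow> 'a set \<Rightarrow> 'a set \<Rightarrow> bool" where
  "bisection V V1 V2 \<longleftrightarrow>
     V1 \<union> V2 = V \<and> V1 \<inter> V2 = {} \<and> \<bar>int (card V1) - int (card V2)\<bar> \<le> 1"

definition cut_size :: "'a set set \<Rightarrow> 'a set \<Rightarrow> 'a set \<Rightarrow> nat" where
  "cut_size E V1 V2 = card {e \<in> E. \<exists>u\<in>V1. \<exists>v\<in>V2. e = {u, v}}"

definition edges_within :: "'a set set \<Rightarrow> 'a set \<Rightarrow> nat" where
  "edges_within E U = card {e \<in> E. e \<subseteq> U}"

end

(* The graphs are fans with one rim edge removed. If a vertex 0 is adjacent to all of the other
   2k - 1 vertices, then in every bisection the part containing 0 spans at least k - 1 edges. Adding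
   2k - 3 edges of a path on the other vertices gives m = 4(k - 1) edges, so this bound equals m/4.
   The path is bipartite, with classes that extend to a bisection in which the only uncut edges are
   the k - 1 edges from 0 into its own part, so 3m/4 edges are cut. *)

theory Submission
  imports Defs
begin

text \<open>For k \<ge> 2 the rim path runs through 1, ..., 2k - 2, so the last vertex 2k - 1 has
  the hub 0 as its only neighbour. A full fan would have 4k - 3 edges, and a quarter of that exceeds
  the k - 1 edges guaranteed around the hub; dropping one rim edge makes the two agree.\<close>

definition fan_edges :: "nat \<Rightarrow> nat set set" where
  "fan_edges k = (\<lambda>j. {0, j}) ` {1..<2 * k} \<union> (\<lambda>i. {i, Suc i}) ` {1..2 * k - 3}"

lemma card_hub_edges:
  assumes "h \<notin> A"
  shows "card ((\<lambda>j. {h, j}) ` A) = card A"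
  using assms by (intro card_image) (auto simp: inj_on_def doubleton_eq_iff)

text \<open>The smaller endpoint of a rim edge determines its index.\<close>

lemma card_rim_edges: "card ((\<lambda>i::nat. {i, Suc i}) ` A) = card A"
  by (intro card_image) (auto simp: inj_on_def doubleton_eq_iff)

text \<open>\<open>Suc i\<close> is never 0, so a rim edge could meet the hub only through
  \<open>i = 0\<close>.\<close>

lemma hub_rim_disjoint: "0 \<notin> B \<Longrightarrow> (\<lambda>j::nat. {0, j}) ` A \<inter> (\<lambda>i. {i, Suc i}) ` B = {}"
  by (auto simp: doubleton_eq_iff)

lemma finite_simple_graph_fan: "finite_simple_graph {..<2 * k} (fan_edges k)"
  by (auto simp: finite_simple_graph_def fan_edges_def)

lemma finite_fan_edges: "finite (fan_edges k)"
  by (simp add: fan_edges_def)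

lemma card_fan_edges:
  assumes "k \<ge> 2"
  shows "card (fan_edges k) = 4 * (k - 1)"
proof -
  have "card (fan_edges k) = card {1..<2 * k} + card {1..2 * k - 3}"
    unfolding fan_edges_def
    by (subst card_Un_disjoint) (simp_all add: hub_rim_disjoint card_hub_edges card_rim_edges)
  then show ?thesis
    using assms by simp
qed

lemma card_odds_below: "card ((\<lambda>i. Suc (2 * i)) ` {..<k}) = k"
  by (subst card_image) (auto simp: inj_on_def)

lemma bisection_even_odd:
  "bisection {..<2 * k} ((\<lambda>i. 2 * i) ` {..<k}) ((\<lambda>i. Suc (2 * i)) ` {..<k})"
  (is "bisection _ ?V1 ?V2")
  unfolding bisection_def
proof (intro conjI)
  have "x \<in> ?V1 \<union> ?V2" if "x < 2 * k" for x
  proof (cases "even x")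
    case True
    then have "x = 2 * (x div 2)" "x div 2 < k" using that by auto
    then show ?thesis by blast
  next
    case False
    then have "x = Suc (2 * (x div 2))" "x div 2 < k" using that by auto
    then show ?thesis by blast
  qed
  then show "?V1 \<union> ?V2 = {..<2 * k}" by auto
  have "2 * i \<noteq> Suc (2 * j)" for i j :: nat
    by presburger
  then show "?V1 \<inter> ?V2 = {}" by blast
  have "card ?V1 = k"
    by (subst card_image) (auto simp: inj_on_def)
  then show "\<bar>int (card ?V1) - int (card ?V2)\<bar> \<le> 1"
    by (simp add: card_odds_below)
qed

text \<open>The hub is even, so its edges to the k odd vertices are cut; all 2k - 3 rim edges join
  consecutive numbers and are cut too. Together this gives k + (2k - 3) = 3(k - 1).\<close>

lemma cut_size_even_odd:
  assumes "k \<ge> 2"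
  shows "cut_size (fan_edges k) ((\<lambda>i. 2 * i) ` {..<k}) ((\<lambda>i. Suc (2 * i)) ` {..<k}) \<ge> 3 * (k - 1)"
proof -
  let ?V1 = "(\<lambda>i::nat. 2 * i) ` {..<k}" and ?V2 = "(\<lambda>i::nat. Suc (2 * i)) ` {..<k}"
  let ?C = "{e \<in> fan_edges k. \<exists>u\<in>?V1. \<exists>v\<in>?V2. e = {u, v}}"
  let ?H = "(\<lambda>j. {0, j}) ` ?V2" and ?R = "(\<lambda>i::nat. {i, Suc i}) ` {1..2 * k - 3}"
  have "{0, j} \<in> ?C" if "j \<in> ?V2" for j
  proof -
    have "0 \<in> ?V1" "j \<in> {1..<2 * k}"
      using assms that by auto
    then show ?thesis
      using that unfolding fan_edges_def by blast
  qed
  then have "?H \<subseteq> ?C" by blast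
  moreover have "{i, Suc i} \<in> ?C" if i: "i \<in> {1..2 * k - 3}" for i
  proof -
    have edge: "{i, Suc i} \<in> fan_edges k"
      using i by (auto simp: fan_edges_def)
    show ?thesis
    proof (cases "even i")
      case True
      then obtain j where "i = 2 * j" by (elim evenE)
      then have "i \<in> ?V1" "Suc i \<in> ?V2" using i by auto
      then show ?thesis using edge by blast
    next
      case False
      then obtain j where "i = Suc (2 * j)" by (auto elim: oddE)
      \<comment> \<open>From i \<le> 2k - 3 it follows that \<open>Suc i\<close> is at most 2(k -
        1), which keeps its index \<open>Suc j\<close> below k.\<close>
      then have "i = Suc (2 * j)" "Suc i = 2 * Suc j" "j < k" "Suc j < k" using i by auto
      then have "Suc i \<in> ?V1" "i \<in> ?V2" by blast+
      \<comment> \<open>Here the even endpoint is \<open>Suc i\<close>, so the pair must be swapped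
        to list the endpoint in \<open>?V1\<close> first.\<close>
      then show ?thesis using edge insert_commute by blast
    qed
  qed
  then have "?R \<subseteq> ?C" by blast
  ultimately have "card (?H \<union> ?R) \<le> card ?C"
    using finite_fan_edges by (intro card_mono) auto
  moreover have "card (?H \<union> ?R) = card ?V2 + card {1..2 * k - 3}"
    by (subst card_Un_disjoint)
      (simp_all add: hub_rim_disjoint card_hub_edges card_rim_edges image_iff)
  ultimately show ?thesis
    unfolding cut_size_def card_odds_below using assms by simp
qed

lemma edges_within_hub_ge:
  assumes "finite E" "h \<in> U" and hub: "\<And>j. j \<in> U - {h} \<Longrightarrow> {h, j} \<in> E"
  shows "card U - 1 \<le> edges_within E U"
proof -
  have "card U - 1 = card ((\<lambda>j. {h, j}) ` (U - {h}))"
    using \<open>h \<in> U\<close> by (simp add: card_hub_edges)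
  also have "\<dots> \<le> edges_within E U"
    unfolding edges_within_def using assms by (intro card_mono) auto
  finally show ?thesis .
qed

text \<open>Two sizes with an even sum have an even difference, so a difference of at most 1 is
  0.\<close>

lemma bisection_card_even:
  assumes "bisection V V1 V2" "finite V" "card V = 2 * k"
  shows "card V1 = k" "card V2 = k"
proof -
  have "card V1 + card V2 = 2 * k"
    using assms by (auto simp: bisection_def card_Un_disjoint)
  moreover have "\<bar>int (card V1) - int (card V2)\<bar> \<le> 1"
    using assms(1) by (simp add: bisection_def)
  ultimately show "card V1 = k" "card V2 = k"
    by linarith+
qed

lemma fan_bisection_max_ge:
  assumes "k \<ge> 2" and bis: "bisection {..<2 * k} V1 V2"
  shows "k - 1 \<le> max (edges_within (fan_edges k) V1) (edges_within (fan_edges k) V2)"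
proof -
  have V: "V1 \<union> V2 = {..<2 * k}"
    using bis by (simp add: bisection_def)
  \<comment> \<open>Kept general in \<open>U\<close> because either part may be the one containing
    the hub.\<close>
  have side: "card U - 1 \<le> edges_within (fan_edges k) U" if "0 \<in> U" "U \<subseteq> {..<2 * k}" for U
  proof (rule edges_within_hub_ge[OF finite_fan_edges \<open>0 \<in> U\<close>])
    fix j assume "j \<in> U - {0}"
    then have "j \<in> {1..<2 * k}"
      using that(2) by auto
    then show "{0, j} \<in> fan_edges k"
      unfolding fan_edges_def by blast
  qed
  have "0 \<in> V1 \<union> V2"
    using V assms(1) by simp
  moreover have "card V1 = k" "card V2 = k"
    using bisection_card_even[OF bis] by simp_all
  moreover have "V1 \<subseteq> {..<2 * k}" "V2 \<subseteq> {..<2 * k}"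
    using V by auto
  ultimately show ?thesis
    using side[of V1] side[of V2] unfolding le_max_iff_disj by (metis Un_iff)
qed

theorem proposition1p12:
  "\<forall>N::nat. \<exists>m\<ge>N. \<exists>(V :: nat set) E.
     finite_simple_graph V E \<and> card E = m \<and>
     (\<exists>V1 V2. bisection V V1 V2 \<and> real (cut_size E V1 V2) \<ge> 3 / 4 * real m) \<and>
     (\<forall>V1 V2. bisection V V1 V2 \<longrightarrow>
        real (max (edges_within E V1) (edges_within E V2)) \<ge> real m / 4)"
proof
  fix N :: nat
  \<comment> \<open>This secures k \<ge> 2 and makes the number of edges 4(k - 1) = 4N + 4, which is
    at least N.\<close>
  define k where "k = N + 2"
  have k: "k \<ge> 2" by (simp add: k_def)
  show "\<exists>m\<ge>N. \<exists>(V :: nat set) E.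
     finite_simple_graph V E \<and> card E = m \<and>
     (\<exists>V1 V2. bisection V V1 V2 \<and> real (cut_size E V1 V2) \<ge> 3 / 4 * real m) \<and>
     (\<forall>V1 V2. bisection V V1 V2 \<longrightarrow>
        real (max (edges_within E V1) (edges_within E V2)) \<ge> real m / 4)"
  proof (intro exI conjI allI impI)
    show "N \<le> 4 * (k - 1)" by (simp add: k_def)
    show "finite_simple_graph {..<2 * k} (fan_edges k)" by (rule finite_simple_graph_fan)
    show "card (fan_edges k) = 4 * (k - 1)" using k by (rule card_fan_edges)
    show "bisection {..<2 * k} ((\<lambda>i. 2 * i) ` {..<k}) ((\<lambda>i. Suc (2 * i)) ` {..<k})"
      by (rule bisection_even_odd)
    show "3 / 4 * real (4 * (k - 1)) \<le>
        real (cut_size (fan_edges k) ((\<lambda>i. 2 * i) ` {..<k}) ((\<lambda>i. Suc (2 * i)) ` {..<k}))"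
      using of_nat_mono[OF cut_size_even_odd[OF k], where 'a = real] by simp
    show "real (4 * (k - 1)) / 4 \<le>
        real (max (edges_within (fan_edges k) V1) (edges_within (fan_edges k) V2))"
      if "bisection {..<2 * k} V1 V2" for V1 V2
      using of_nat_mono[OF fan_bisection_max_ge[OF k that], where 'a = real] by simp
  qed
qed

end
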